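(* Consider the uncertain linear system with real matrices $A\in\mathbf{R}^{n\times n}$, $B_1\in\mathbf{R}^{n\times m}$, $B_2\in\mathbf{R}^{n\times r}$, $C_1\in\mathbf{R}^{h\times n}$, $D_1\in\mathbf{R}^{h\times m}$, $C_2\in\mathbf{R}^{l\times n}$, $D_2\in\mathbf{R}^{l\times r}$, as described in the context. Suppose that $H(s)=C_1(sI-A)^{-1}B_1+D_1\equiv 0$. Then a non-zero state $x_0\in\mathbf{R}^n$ is differentially possibly controllable if and only if it is a controllable state for the pair $(A,B_1)$.
   Context: System: $\dot x(t)=Ax(t)+B_1u(t)+B_2\xi(t)$, $z(t)=C_1x(t)+D_1u(t)$, $y(t)=C_2x(t)+D_2\xi(t)$, where $x\in\mathbf{R}^n$ is the state, $u\in\mathbf{R}^m$ the control input, $\xi\in\mathbf{R}^r$ the uncertainty input, $z\in\mathbf{R}^h$ the uncertainty output and $y\in\mathbf{R}^l$ the measured output. Averaged integral quadratic constraint: let $T>0$ and $d>0$. For any integer $q\ge 1$, consider sequences of uncertainty inputs $\{\xi^1,\dots,\xi^q\}$ and of control inputs $\{u^1,\dots,u^q\}$ with $\xi^i,u^i\in \mathbf{L}_2[0,T]$, and let $x^i,z^i$ be the corresponding state and uncertainty output on $[0,T]$ with $x^i(0)=x_0$. The sequence is admissible (for the given $d$) if $$\frac1q\sum_{i=1}^q\int_0^T\left(\|\xi^i(t)\|^2-\|z^i(t)\|^2\right)dt\le d.$$ Possible controllability function: $$L_c(x_0,T)=\sup_{\epsilon>0}\ \inf\ \frac1q\sum_{i=1}^q\left[\frac{\|x^i(T)\|^2}{\epsilon}+\int_0^T\|u^i(t)\|^2dt\right],$$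 where the infimum is over all $q\ge1$ and all admissible sequences $\{\xi^i\}_{i=1}^q$, $\{u^i\}_{i=1}^q$ with $x^i(0)=x_0$. It depends on $d$. A non-zero state $x_0$ is possibly controllable on $[0,T]$ if $\sup_{d>0}L_c(x_0,T)<\infty$. It is (differentially) possibly controllable if it is possibly controllable on $[0,T]$ for all sufficiently small $T>0$. A state $x_0$ is a controllable state for a pair $(A,B)$ if it lies in the controllable subspace of $(A,B)$, i.e. the range of $[B\ AB\ \cdots\ A^{n-1}B]$. *)

theory Defs
  imports "HOL-Analysis.Analysis"
begin

text \<open>
  \<open>x' = A x + B\<^sub>1 u + B\<^sub>2 \<xi>\<close>, \<open>z = C\<^sub>1 x + D\<^sub>1 u\<close>, \<open>y = C\<^sub>2 x + D\<^sub>2 \<xi>\<close>. The dimensions of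
  state, control input, uncertainty input, uncertainty output and measured output are the
  cardinalities of \<open>'n\<close>, \<open>'m\<close>, \<open>'r\<close>, \<open>'h\<close>, \<open>'l\<close>; note that \<open>real^'b^'a\<close> is the type of
  matrices with \<open>'a\<close> rows and \<open>'b\<close> columns.
\<close>

record ('n, 'm, 'r, 'h, 'l) uncertain_system =
  sysA  :: "real^'n^'n"
  sysB1 :: "real^'m^'n"
  sysB2 :: "real^'r^'n"
  sysC1 :: "real^'n^'h"
  sysD1 :: "real^'m^'h"
  sysC2 :: "real^'n^'l"
  sysD2 :: "real^'r^'l"

definition L2_on :: "real set \<Rightarrow> (real \<Rightarrow> 'a::euclidean_space) \<Rightarrow> bool" where
  "L2_on I f \<longleftrightarrow>
     set_borel_measurable lebesgue I f \<and> set_integrable lebesgue I (\<lambda>t. (norm (f t))\<^sup>2)"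

text \<open>
  Since the inputs are only square integrable, the differential equation is understood in
  the sense of Caratheodory, that is, in integrated form. Only the values on \<open>[0,T]\<close> matter.
\<close>

definition state_trajectory ::
  "('n::finite, 'm::finite, 'r::finite, 'h::finite, 'l::finite) uncertain_system \<Rightarrow> real \<Rightarrow> real^'n \<Rightarrow>
   (real \<Rightarrow> real^'m) \<Rightarrow> (real \<Rightarrow> real^'r) \<Rightarrow> (real \<Rightarrow> real^'n) \<Rightarrow> bool" where
  "state_trajectory S T x0 u \<xi> x \<longleftrightarrow>
     continuous_on {0..T} x \<and>
     (\<forall>t\<in>{0..T}. x t = x0 +
        (LINT s:{0..t}|lebesgue. sysA S *v x s + sysB1 S *v u s + sysB2 S *v \<xi> s))"

definition uncertainty_output ::
  "('n::finite, 'm::finite, 'r::finite, 'h::finite, 'l::finite) uncertain_system \<Rightarrow>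
   (real \<Rightarrow> real^'n) \<Rightarrow> (real \<Rightarrow> real^'m) \<Rightarrow> real \<Rightarrow> real^'h" where
  "uncertainty_output S x u t = sysC1 S *v x t + sysD1 S *v u t"

definition measured_output ::
  "('n::finite, 'm::finite, 'r::finite, 'h::finite, 'l::finite) uncertain_system \<Rightarrow>
   (real \<Rightarrow> real^'n) \<Rightarrow> (real \<Rightarrow> real^'r) \<Rightarrow> real \<Rightarrow> real^'l" where
  "measured_output S x \<xi> t = sysC2 S *v x t + sysD2 S *v \<xi> t"

text \<open>
  A sequence of length \<open>q\<close> is a function on \<open>nat\<close> of which only the values at \<open>1, \<dots>, q\<close>
  are used.
\<close>

definition admissible ::
  "('n::finite, 'm::finite, 'r::finite, 'h::finite, 'l::finite) uncertain_system \<Rightarrow> real \<Rightarrow> real \<Rightarrow> real^'n \<Rightarrow>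
   nat \<Rightarrow> (nat \<Rightarrow> real \<Rightarrow> real^'m) \<Rightarrow> (nat \<Rightarrow> real \<Rightarrow> real^'r) \<Rightarrow> (nat \<Rightarrow> real \<Rightarrow> real^'n) \<Rightarrow> bool" where
  "admissible S d T x0 q u \<xi> x \<longleftrightarrow>
     q \<ge> 1 \<and>
     (\<forall>i\<in>{1..q}. L2_on {0..T} (u i) \<and> L2_on {0..T} (\<xi> i) \<and>
        state_trajectory S T x0 (u i) (\<xi> i) (x i)) \<and>
     (1 / real q) * (\<Sum>i=1..q. LINT t:{0..T}|lebesgue.
        (norm (\<xi> i t))\<^sup>2 - (norm (uncertainty_output S (x i) (u i) t))\<^sup>2) \<le> d"

definition averaged_cost ::
  "real \<Rightarrow> real \<Rightarrow> nat \<Rightarrow> (nat \<Rightarrow> real \<Rightarrow> real^'m::finite) \<Rightarrow> (nat \<Rightarrow> real \<Rightarrow> real^'n::finite) \<Rightarrow> real" where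
  "averaged_cost \<epsilon> T q u x =
     (1 / real q) * (\<Sum>i=1..q. (norm (x i T))\<^sup>2 / \<epsilon> + (LINT t:{0..T}|lebesgue. (norm (u i t))\<^sup>2))"

definition possible_controllability_function ::
  "('n::finite, 'm::finite, 'r::finite, 'h::finite, 'l::finite) uncertain_system \<Rightarrow> real \<Rightarrow> real^'n \<Rightarrow> real \<Rightarrow> ereal" where
  "possible_controllability_function S d x0 T =
     (SUP \<epsilon>\<in>{0<..}. INF (q, u, \<xi>, x)\<in>{(q, u, \<xi>, x). admissible S d T x0 q u \<xi> x}.
        ereal (averaged_cost \<epsilon> T q u x))"

definition possibly_controllable_on ::
  "('n::finite, 'm::finite, 'r::finite, 'h::finite, 'l::finite) uncertain_system \<Rightarrow> real \<Rightarrow> real^'n \<Rightarrow> bool" where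
  "possibly_controllable_on S T x0 \<longleftrightarrow>
     (SUP d\<in>{0<..}. possible_controllability_function S d x0 T) < \<infinity>"

definition differentially_possibly_controllable ::
  "('n::finite, 'm::finite, 'r::finite, 'h::finite, 'l::finite) uncertain_system \<Rightarrow> real^'n \<Rightarrow> bool" where
  "differentially_possibly_controllable S x0 \<longleftrightarrow>
     (\<exists>T0>0. \<forall>T. 0 < T \<and> T < T0 \<longrightarrow> possibly_controllable_on S T x0)"

text \<open>
  On matrices \<open>*\<close> and hence \<open>^\<close> are componentwise, so powers with respect to \<open>**\<close> have to
  be defined separately.
\<close>

definition matrix_power :: "'a::semiring_1^'n::finite^'n \<Rightarrow> nat \<Rightarrow> 'a^'n^'n" where
  "matrix_power A k = (((**) A) ^^ k) (mat 1)"

text \<open>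
  The range of the block matrix \<open>[B, A B, \<dots>, A\<^sup>n\<^sup>-\<^sup>1 B]\<close>: an argument of that matrix consists
  of blocks \<open>w 0, \<dots>, w (n - 1)\<close>, which are mapped to \<open>\<Sum>k<n. A\<^sup>k B (w k)\<close>.
\<close>

definition controllable_subspace :: "real^'n::finite^'n \<Rightarrow> real^'m::finite^'n \<Rightarrow> (real^'n) set" where
  "controllable_subspace A B =
     range (\<lambda>w :: nat \<Rightarrow> real^'m. \<Sum>k<CARD('n). (matrix_power A k ** B) *v w k)"

definition controllable_state :: "real^'n::finite^'n \<Rightarrow> real^'m::finite^'n \<Rightarrow> real^'n \<Rightarrow> bool" where
  "controllable_state A B x0 \<longleftrightarrow> x0 \<in> controllable_subspace A B"

abbreviation complex_matrix :: "real^'b::finite^'a::finite \<Rightarrow> complex^'b^'a" where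
  "complex_matrix \<equiv> map_matrix complex_of_real"

text \<open>
  \<open>mat s\<close> is \<open>s I\<close>. \<open>matrix_inv\<close> is unspecified on singular matrices, so the value of the
  transfer function is meaningful only where \<open>resolvent_defined\<close> holds.
\<close>

definition resolvent_defined :: "real^'n::finite^'n \<Rightarrow> complex \<Rightarrow> bool" where
  "resolvent_defined A s \<longleftrightarrow> invertible (mat s - complex_matrix A)"

definition transfer_function ::
  "real^'n::finite^'n \<Rightarrow> real^'m::finite^'n \<Rightarrow> real^'n^'h::finite \<Rightarrow> real^'m^'h \<Rightarrow> complex \<Rightarrow> complex^'m^'h" where
  "transfer_function A B C D s =
     complex_matrix C ** matrix_inv (mat s - complex_matrix A) ** complex_matrix B + complex_matrix D"

end

theory Submission
  imports Defs "HOL-Computational_Algebra.Polynomial"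
begin

text \<open>
  Let \<open>V\<close> be the controllable subspace of \<open>(A, B\<^sub>1)\<close>. Expanding the transfer function at infinity,
  \<open>H = 0\<close> means that \<open>D\<^sub>1 = 0\<close> and that \<open>C\<^sub>1\<close> vanishes on \<open>V\<close>.

  If \<open>x0 \<in> V\<close>, take \<open>\<xi> = 0\<close> and a control that steers \<open>x0\<close> to \<open>0\<close> inside \<open>V\<close>. Then \<open>z = 0\<close>, so the
  constraint holds for every \<open>d > 0\<close>, and the cost does not depend on \<open>d\<close> and \<open>\<epsilon>\<close>. The control is a
  polynomial, found from a flat output: in the single-input system on \<open>v, A v, A\<^sup>2 v, \<dots>\<close> the last
  coordinate and its derivatives determine all other coordinates and the input.

  Conversely, let \<open>P\<close> be a projection with kernel \<open>V\<close>. The function \<open>P x\<close> satisfies a linear equation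
  driven by \<open>\<xi>\<close> alone, and \<open>z = C\<^sub>1 P x\<close>. Bounded cost for all \<open>\<epsilon>\<close> forces \<open>P x(T)\<close> to be arbitrarily
  small, so \<open>\<xi>\<close> has to cancel \<open>P x0\<close>; but the constraint bounds the energy of \<open>\<xi>\<close> by that of \<open>z\<close>,
  which is of order \<open>T\<close>, and so for small \<open>T\<close> this is possible only if \<open>P x0 = 0\<close>.
\<close>

section \<open>Steering in Krylov subspaces\<close>

lemma span_image_lessThan_sum:
  fixes g :: "nat \<Rightarrow> 'a::real_vector"
  assumes "y \<in> span (g ` {..<n})"
  shows "\<exists>c. y = (\<Sum>k<n. c k *\<^sub>R g k)"
  using assms
proof (induction n arbitrary: y)
  case 0
  then show ?case by simp
next
  case (Suc n)
  then obtain r where "y - r *\<^sub>R g n \<in> span (g ` {..<n})"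
    by (auto simp: lessThan_Suc span_breakdown_eq)
  then obtain c where "y - r *\<^sub>R g n = (\<Sum>k<n. c k *\<^sub>R g k)"
    using Suc.IH by blast
  then have "y = (\<Sum>k<Suc n. (c(n := r)) k *\<^sub>R g k)"
    by (simp add: algebra_simps)
  then show ?case by blast
qed

text \<open>More than \<open>DIM('a)\<close> vectors are dependent, so some iterate lies in the span
  of its predecessors; applying \<open>f\<close> carries this property up to index
  \<open>DIM('a)\<close>. This serves in place of the Cayley-Hamilton theorem.\<close>

lemma Krylov_dependence:
  fixes f :: "'a::euclidean_space \<Rightarrow> 'a"
  assumes "linear f"
  shows "\<exists>c. (f ^^ DIM('a)) v = (\<Sum>k<DIM('a). c k *\<^sub>R (f ^^ k) v)"
proof -
  define g where "g k = (f ^^ k) v" for k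
  have "\<exists>k\<le>DIM('a). g k \<in> span (g ` {..<k})"
  proof (rule ccontr)
    assume "\<not> ?thesis"
    then have new: "g k \<notin> span (g ` {..<k})" if "k \<le> DIM('a)" for k
      using that by blast
    have "independent (g ` {..<k}) \<and> card (g ` {..<k}) = k" if "k \<le> Suc DIM('a)" for k
      using that
    proof (induction k)
      case (Suc k)
      then have "g k \<notin> span (g ` {..<k})" using new[of k] by simp
      moreover from this have "g k \<notin> g ` {..<k}" by (meson span_base)
      ultimately show ?case using Suc
        by (simp add: lessThan_Suc independent_insert)
    qed (simp add: independent_empty)
    from this[of "Suc DIM('a)"] show False
      using independent_bound[of "g ` {..<Suc DIM('a)}"] by simp
  qed
  then obtain k where k: "k \<le> DIM('a)" "g k \<in> span (g ` {..<k})" by blast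
  have "g m \<in> span (g ` {..<m})" if "k \<le> m" for m
    using that
  proof (induction m rule: dec_induct)
    case base
    show ?case by (rule k(2))
  next
    case (step m)
    have "g (Suc m) = f (g m)" by (simp add: g_def)
    also have "\<dots> \<in> f ` span (g ` {..<m})" using step by blast
    also have "\<dots> = span (f ` g ` {..<m})" by (simp add: assms linear_span_image)
    also have "\<dots> \<subseteq> span (g ` {..<Suc m})"
    proof (rule span_mono)
      show "f ` g ` {..<m} \<subseteq> g ` {..<Suc m}"
      proof clarify
        fix j assume "j < m"
        have "f (g j) = g (Suc j)" by (simp add: g_def)
        with \<open>j < m\<close> show "f (g j) \<in> g ` {..<Suc m}" by auto
      qed
    qed
    finally show ?case .
  qed
  from this[OF k(1)] show ?thesis
    using span_image_lessThan_sum by (fastforce simp: g_def)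
qed

section \<open>Flat outputs and their order of vanishing at the end points\<close>

lemma power_dvd_pderiv:
  fixes p q :: "'a::idom poly"
  assumes "p ^ Suc m dvd q"
  shows "p ^ m dvd pderiv q"
proof -
  obtain r where "q = p ^ Suc m * r" using assms by (elim dvdE)
  then have "pderiv q = p ^ m * (p * pderiv r + smult (of_nat (Suc m)) (pderiv p * r))"
    by (simp only: pderiv_mult pderiv_power_Suc) (simp add: algebra_simps)
  then show ?thesis by simp
qed

text \<open>
  If \<open>f\<^sup>n v = (\<Sum>k<n. c\<^sub>k f\<^sup>k v)\<close> and \<open>x = (\<Sum>k<n. \<phi>\<^sub>k f\<^sup>k v)\<close>, then \<open>x' = f x + u v\<close> amounts to
  \<open>\<phi>\<^sub>k' = \<phi>\<^sub>k\<^sub>-\<^sub>1 + c\<^sub>k \<phi>\<^sub>n\<^sub>-\<^sub>1\<close> with \<open>\<phi>\<^sub>-\<^sub>1 = u\<close>. Hence \<open>y = \<phi>\<^sub>n\<^sub>-\<^sub>1\<close> can be chosen freely, and \<open>\<phi>\<^sub>n\<^sub>-\<^sub>1\<^sub>-\<^sub>j\<close> is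
  \<open>flat a y j\<close> with \<open>a\<^sub>j = c\<^sub>n\<^sub>-\<^sub>1\<^sub>-\<^sub>j\<close>.
\<close>

primrec flat :: "(nat \<Rightarrow> real) \<Rightarrow> real poly \<Rightarrow> nat \<Rightarrow> real poly" where
  "flat a y 0 = y"
| "flat a y (Suc j) = pderiv (flat a y j) - smult (a j) y"

lemma flat_add_smult:
  "flat a (y + smult r z) j = flat a y j + smult r (flat a z j)"
  by (induction j) (simp_all add: pderiv_add pderiv_smult algebra_simps smult_add_right smult_diff_right)

text \<open>Each step differentiates once and subtracts a multiple of \<open>y\<close>, so at most
  one order of vanishing is lost.\<close>

lemma power_dvd_flat:
  assumes "p ^ n dvd y" "j \<le> n"
  shows "p ^ (n - j) dvd flat a y j"
  using assms(2)
proof (induction j)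
  case (Suc j)
  then have "p ^ Suc (n - Suc j) dvd flat a y j" by (simp add: Suc_diff_Suc)
  then have "p ^ (n - Suc j) dvd pderiv (flat a y j)" by (rule power_dvd_pderiv)
  moreover have "p ^ (n - Suc j) dvd y"
    using assms(1) power_le_dvd[of p n y "n - Suc j"] by simp
  ultimately show ?case by (simp add: dvd_diff dvd_smult)
qed (simp add: assms)

text \<open>The order of vanishing at 0 drops by exactly one per step: differentiation lowers it by
  one, while the subtracted multiple of the flat output still vanishes to order at least
  \<open>n\<close>.\<close>

lemma flat_at_root_nonzero:
  assumes "poly g 0 \<noteq> 0" "j \<le> n"
  shows "\<exists>h. flat a ([:0, 1:] ^ n * g) j = [:0, 1:] ^ (n - j) * h \<and> poly h 0 \<noteq> 0"
  using assms(2)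
proof (induction j)
  case 0
  show ?case using assms(1) by auto
next
  case (Suc j)
  then obtain h where h: "flat a ([:0, 1:] ^ n * g) j = [:0, 1:] ^ (n - j) * h" "poly h 0 \<noteq> 0"
    by auto
  define m where "m = n - Suc j"
  have m: "n - j = Suc m" "n = m + Suc j" using Suc.prems by (auto simp: m_def)
  \<comment> \<open>Quotient by \<open>[:0, 1:] ^ m\<close>; at 0 only its first term survives, with
    value \<open>Suc m\<close> times \<open>poly h 0\<close>.\<close>
  define h' where "h' = smult (of_nat (Suc m)) h + [:0, 1:] * pderiv h - smult (a j) ([:0, 1:] ^ Suc j * g)"
  have "pderiv ([:0, 1:] ^ Suc m * h) =
      [:0, 1:] ^ m * (smult (of_nat (Suc m)) h + [:0, 1:] * pderiv h)"
    by (simp only: pderiv_mult pderiv_power_Suc) (simp add: pderiv_pCons algebra_simps)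
  moreover have "smult (a j) ([:0, 1:] ^ n * g) = [:0, 1:] ^ m * smult (a j) ([:0, 1:] ^ Suc j * g)"
    by (simp only: m(2) power_add) (simp add: algebra_simps)
  ultimately have "flat a ([:0, 1:] ^ n * g) (Suc j) = [:0, 1:] ^ m * h'"
    by (simp only: flat.simps h(1) m(1) h'_def right_diff_distrib)
  moreover have "poly h' 0 \<noteq> 0" using h(2) by (simp add: h'_def)
  ultimately show ?case unfolding m_def by blast
qed

text \<open>The conditions at 0 form a triangular system: adding a multiple of
  \<open>[:0, 1:] ^ n * [:-T, 1:] ^ N\<close> changes \<open>flat\<close> number \<open>n\<close> at
  0 but none before it, and keeps the zero at \<open>T\<close>.\<close>

lemma flat_interpolation:
  assumes "T \<noteq> 0"
  shows "\<exists>y. [:-T, 1:] ^ N dvd y \<and> (\<forall>j<n. poly (flat a y j) 0 = b j)"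
proof (induction n)
  case 0
  show ?case by auto
next
  case (Suc n)
  then obtain y where y: "[:-T, 1:] ^ N dvd y" "\<And>j. j < n \<Longrightarrow> poly (flat a y j) 0 = b j"
    by blast
  define g where "g = [:-T, 1:] ^ N"
  define z where "z = [:0, 1:] ^ n * g"
  have g0: "poly g 0 \<noteq> 0" using assms by (simp add: g_def)
  have low: "poly (flat a z j) 0 = 0" if "j < n" for j
    using flat_at_root_nonzero[OF g0, of j n a] that by (auto simp: z_def)
  have high: "poly (flat a z n) 0 \<noteq> 0"
    using flat_at_root_nonzero[OF g0, of n n a] by (auto simp: z_def)
  define r where "r = (b n - poly (flat a y n) 0) / poly (flat a z n) 0"
  have "poly (flat a (y + smult r z) j) 0 = b j" if "j < Suc n" for j
    using that y(2) low high by (cases "j = n") (auto simp: flat_add_smult r_def)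
  moreover have "[:-T, 1:] ^ N dvd y + smult r z"
    using y(1) by (simp add: z_def g_def dvd_smult)
  ultimately show ?case by blast
qed

text \<open>The flat output is interpolated so that its data at 0 produce the coefficients
  \<open>b\<close>, while its zero of order \<open>n\<close> at \<open>T\<close> forces every
  coordinate to vanish there.\<close>

lemma Krylov_steering:
  fixes f :: "'a::euclidean_space \<Rightarrow> 'a"
  assumes f: "linear f" and "T \<noteq> 0"
    and dep: "(f ^^ n) v = (\<Sum>k<n. c k *\<^sub>R (f ^^ k) v)"
  shows "\<exists>x u. x 0 = (\<Sum>k<n. b k *\<^sub>R (f ^^ k) v) \<and> x T = 0 \<and> continuous_on UNIV u \<and>
    (\<forall>t. (x has_vector_derivative f (x t) + u t *\<^sub>R v) (at t)) \<and>
    (\<forall>t. x t \<in> span (range (\<lambda>k. (f ^^ k) v)))"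
proof -
  define a where "a j = c (n - Suc j)" for j
  obtain y where y: "[:-T, 1:] ^ n dvd y"
      "\<And>j. j < n \<Longrightarrow> poly (flat a y j) 0 = b (n - Suc j)"
    using flat_interpolation[OF \<open>T \<noteq> 0\<close>, of n n a "\<lambda>j. b (n - Suc j)"] by blast
  define \<phi> where "\<phi> k = flat a y (n - Suc k)" for k
  define x where "x t = (\<Sum>k<n. poly (\<phi> k) t *\<^sub>R (f ^^ k) v)" for t
  define u where "u t = poly (flat a y n) t" for t
  have "poly (\<phi> k) 0 = b k" if "k < n" for k
    using y(2)[of "n - Suc k"] that by (simp add: \<phi>_def)
  then have "x 0 = (\<Sum>k<n. b k *\<^sub>R (f ^^ k) v)" by (simp add: x_def)
  moreover have "poly (\<phi> k) T = 0" if "k < n" for k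
  proof -
    \<comment> \<open>Index \<open>n - Suc k\<close> leaves order
      \<open>n - (n - Suc k) = Suc k\<close>, hence at least a simple zero at
      \<open>T\<close>.\<close>
    have "[:-T, 1:] ^ Suc k dvd \<phi> k"
      using power_dvd_flat[OF y(1), of "n - Suc k" a] that by (simp add: \<phi>_def)
    then have "[:-T, 1:] dvd \<phi> k" by (metis dvd_mult_left power_Suc)
    then show ?thesis by (simp add: poly_eq_0_iff_dvd)
  qed
  then have "x T = 0" by (simp add: x_def)
  moreover have "continuous_on UNIV u"
    unfolding u_def by (intro continuous_intros)
  moreover have "(x has_vector_derivative f (x t) + u t *\<^sub>R v) (at t)" for t
  proof -
    have deriv: "(x has_vector_derivative (\<Sum>k<n. poly (pderiv (\<phi> k)) t *\<^sub>R (f ^^ k) v)) (at t)"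
      unfolding x_def
    proof (rule has_vector_derivative_sum)
      show "((\<lambda>t. poly (\<phi> k) t *\<^sub>R (f ^^ k) v) has_vector_derivative
          poly (pderiv (\<phi> k)) t *\<^sub>R (f ^^ k) v) (at t)" for k
        using has_vector_derivative_scaleR[OF poly_DERIV[of "\<phi> k" t] has_vector_derivative_const[of "(f ^^ k) v"]]
        by simp
    qed
    moreover have "poly (pderiv (\<phi> k)) t = poly (flat a y (n - k)) t + poly y t * c k"
      if "k < n" for k
    proof -
      have "n - k = Suc (n - Suc k)" using that by simp
      then show ?thesis using that by (simp add: \<phi>_def a_def)
    qed
    \<comment> \<open>By \<open>dep\<close>, the terms with \<open>c k\<close> add up to
      \<open>y\<close> times the \<open>n\<close>-th iterate. As \<open>y = flat a y 0\<close>, this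
      is the summand \<open>k = n\<close> of the next sum, whose summand \<open>k = 0\<close> is the
      input term.\<close>
    then have "(\<Sum>k<n. poly (pderiv (\<phi> k)) t *\<^sub>R (f ^^ k) v) =
        (\<Sum>k<n. poly (flat a y (n - k)) t *\<^sub>R (f ^^ k) v) + poly y t *\<^sub>R (f ^^ n) v"
      by (simp add: scaleR_add_left sum.distrib dep scaleR_sum_right)
    also have "\<dots> = (\<Sum>k<Suc n. poly (flat a y (n - k)) t *\<^sub>R (f ^^ k) v)" by simp
    also have "\<dots> = u t *\<^sub>R v + (\<Sum>k<n. poly (\<phi> k) t *\<^sub>R f ((f ^^ k) v))"
      unfolding sum.lessThan_Suc_shift by (simp add: u_def \<phi>_def)
    also have "(\<Sum>k<n. poly (\<phi> k) t *\<^sub>R f ((f ^^ k) v)) = f (x t)"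
      by (simp add: x_def linear_sum[OF f] linear_scale[OF f])
    finally show ?thesis using deriv by (simp add: add.commute)
  qed
  moreover have "x t \<in> span (range (\<lambda>k. (f ^^ k) v))" for t
    unfolding x_def by (intro span_sum span_scale span_base) auto
  ultimately show ?thesis by blast
qed

section \<open>The controllable subspace and the transfer function\<close>

lemma matrix_power_vector_mult: "matrix_power A k *v x = (((*v) A) ^^ k) x"
  by (induction k) (simp_all add: matrix_power_def matrix_vector_mul_assoc[symmetric])

lemma controllable_subspace_eq:
  fixes A :: "real^'n::finite^'n" and B :: "real^'m::finite^'n"
  shows "controllable_subspace A B = range (\<lambda>w. \<Sum>k<CARD('n). (((*v) A) ^^ k) (B *v w k))"
  by (simp add: controllable_subspace_def matrix_vector_mul_assoc[symmetric] matrix_power_vector_mult)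

lemma linear_matrix_iterate: "linear (((*v) (A :: real^'n::finite^'n)) ^^ k)"
proof (induction k)
  case 0
  show ?case by (simp add: linear_iff)
next
  case (Suc k)
  then show ?case using linear_compose[OF Suc matrix_vector_mul_linear[of A]] by (simp add: o_def)
qed

lemma subspace_controllable_subspace:
  fixes A :: "real^'n::finite^'n" and B :: "real^'m::finite^'n"
  shows "subspace (controllable_subspace A B)"
proof -
  note lin = linear_matrix_iterate[where A = A]
  show ?thesis
    unfolding subspace_def controllable_subspace_eq
  proof (intro conjI ballI allI)
    show "0 \<in> range (\<lambda>w. \<Sum>k<CARD('n). (((*v) A) ^^ k) (B *v w k))"
      by (rule image_eqI[where x = "\<lambda>_. 0"]) (simp_all add: linear_0[OF lin])
  next
    fix x y
    assume "x \<in> range (\<lambda>w. \<Sum>k<CARD('n). (((*v) A) ^^ k) (B *v w k))"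
      and "y \<in> range (\<lambda>w. \<Sum>k<CARD('n). (((*v) A) ^^ k) (B *v w k))"
    then obtain w w' where "x = (\<Sum>k<CARD('n). (((*v) A) ^^ k) (B *v w k))"
        "y = (\<Sum>k<CARD('n). (((*v) A) ^^ k) (B *v w' k))" by blast
    then show "x + y \<in> range (\<lambda>w. \<Sum>k<CARD('n). (((*v) A) ^^ k) (B *v w k))"
      by (intro image_eqI[where x = "\<lambda>k. w k + w' k"])
         (simp_all add: sum.distrib matrix_vector_right_distrib linear_add[OF lin])
  next
    fix r :: real and x
    assume "x \<in> range (\<lambda>w. \<Sum>k<CARD('n). (((*v) A) ^^ k) (B *v w k))"
    then obtain w where "x = (\<Sum>k<CARD('n). (((*v) A) ^^ k) (B *v w k))" by blast
    then show "r *\<^sub>R x \<in> range (\<lambda>w. \<Sum>k<CARD('n). (((*v) A) ^^ k) (B *v w k))"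
      by (intro image_eqI[where x = "\<lambda>k. r *\<^sub>R w k"])
         (simp_all add: matrix_vector_mult_scaleR linear_scale[OF lin] scaleR_sum_right)
  qed
qed

text \<open>Powers from \<open>CARD('n)\<close> on reduce to lower ones by the dependence of the
  iterates, so stopping the block matrix at \<open>CARD('n) - 1\<close> loses nothing.\<close>

lemma iterate_in_controllable_subspace:
  fixes A :: "real^'n::finite^'n" and B :: "real^'m::finite^'n"
  shows "(((*v) A) ^^ k) (B *v w) \<in> controllable_subspace A B"
proof -
  note lin = linear_matrix_iterate[where A = A]
  have low: "(((*v) A) ^^ j) (B *v w) \<in> controllable_subspace A B" if "j < CARD('n)" for j w
  proof -
    have "(\<Sum>k<CARD('n). (((*v) A) ^^ k) (B *v (if k = j then w else 0))) =
        (\<Sum>k<CARD('n). if k = j then (((*v) A) ^^ k) (B *v w) else 0)"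
      by (intro sum.cong) (auto simp: linear_0[OF lin])
    also have "\<dots> = (((*v) A) ^^ j) (B *v w)" using that by simp
    finally show ?thesis unfolding controllable_subspace_eq
      by (intro image_eqI[where x = "\<lambda>k. if k = j then w else 0"]) simp_all
  qed
  obtain c where c: "(((*v) A) ^^ CARD('n)) (B *v w) =
      (\<Sum>j<CARD('n). c j *\<^sub>R (((*v) A) ^^ j) (B *v w))"
    using Krylov_dependence[of "(*v) A" "B *v w"] by auto
  show ?thesis
  proof (induction k rule: less_induct)
    case (less k)
    show ?case
    proof (cases "k < CARD('n)")
      case False
      then obtain i where k: "k = i + CARD('n)" by (metis add.commute le_Suc_ex not_less)
      have "(((*v) A) ^^ k) (B *v w) =
          (\<Sum>j<CARD('n). c j *\<^sub>R (((*v) A) ^^ (i + j)) (B *v w))"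
        by (simp add: k funpow_add c linear_sum[OF lin] linear_scale[OF lin])
      also have "\<dots> \<in> controllable_subspace A B"
        using less k by (intro subspace_sum subspace_scale subspace_controllable_subspace) auto
      finally show ?thesis .
    qed (rule low)
  qed
qed

lemma input_in_controllable_subspace: "B *v w \<in> controllable_subspace A B"
  using iterate_in_controllable_subspace[of 0 A B w] by simp

lemma controllable_subspace_invariant:
  fixes A :: "real^'n::finite^'n" and B :: "real^'m::finite^'n"
  assumes "x \<in> controllable_subspace A B"
  shows "A *v x \<in> controllable_subspace A B"
proof -
  obtain w where "x = (\<Sum>k<CARD('n). (((*v) A) ^^ k) (B *v w k))"
    using assms unfolding controllable_subspace_eq by blast
  then have "A *v x = (\<Sum>k<CARD('n). (((*v) A) ^^ Suc k) (B *v w k))"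
    by (simp add: linear_sum[OF matrix_vector_mul_linear])
  then show ?thesis
    by (simp only: subspace_sum subspace_controllable_subspace iterate_in_controllable_subspace)
qed

text \<open>\<open>P\<close> subtracts the components along an orthogonal basis of \<open>V\<close>.
  For \<open>x\<close> in \<open>V\<close>, the vector \<open>P x\<close> is both in
  \<open>V\<close> and orthogonal to \<open>V\<close>, hence 0.\<close>

lemma exists_projection_with_kernel:
  fixes V :: "'a::euclidean_space set"
  assumes "subspace V"
  shows "\<exists>P. linear P \<and> (\<forall>x. P x = 0 \<longleftrightarrow> x \<in> V) \<and> (\<forall>x. x - P x \<in> V)"
proof -
  obtain U where U: "pairwise orthogonal U" "span U = V"
    using orthogonal_basis_subspace[OF assms] by metis
  define P where "P x = x - (\<Sum>b\<in>U. (b \<bullet> x / (b \<bullet> b)) *\<^sub>R b)" for x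
  have lin: "linear P"
    by (rule linearI)
       (simp_all add: P_def inner_add_right add_divide_distrib scaleR_add_left sum.distrib
         scaleR_sum_right scaleR_diff_right)
  have diff: "x - P x \<in> V" for x
    unfolding P_def U(2)[symmetric] by (simp add: span_sum span_scale span_base)
  have "P x = 0" if "x \<in> V" for x
  proof -
    have "P x \<in> V" using subspace_diff[OF assms that diff[of x]] by simp
    then have "orthogonal (P x) (P x)"
      unfolding P_def using Gram_Schmidt_step[OF U(1)] U(2) by blast
    then show ?thesis by (simp add: orthogonal_self)
  qed
  moreover have "x \<in> V" if "P x = 0" for x using diff[of x] that by simp
  ultimately show ?thesis using lin diff by blast
qed

section \<open>The transfer function at real points\<close>

lemma complex_matrix_mult:
  "complex_matrix (A ** B) = complex_matrix A ** complex_matrix B"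
  by (simp add: map_matrix_def matrix_matrix_mult_def vec_eq_iff)

lemma complex_matrix_add:
  "complex_matrix (A + B) = complex_matrix A + complex_matrix B"
  by (simp add: map_matrix_def vec_eq_iff)

lemma complex_matrix_mat: "complex_matrix (mat r) = mat (complex_of_real r)"
  by (simp add: map_matrix_def mat_def vec_eq_iff)

text \<open>\<open>matrix_inv\<close> is a Hilbert choice, so its value is pinned down by uniqueness
  of the two-sided inverse.\<close>

lemma matrix_inv_eqI:
  fixes A :: "'a::semiring_1^'n::finite^'n"
  assumes "A ** N = mat 1" "N ** A = mat 1"
  shows "matrix_inv A = N"
proof -
  have "A ** matrix_inv A = mat 1"
    using assms unfolding matrix_inv_def by (metis (mono_tags, lifting) someI_ex)
  then have "N ** (A ** matrix_inv A) = N" by simp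
  then show ?thesis by (simp add: matrix_mul_assoc assms(2))
qed

text \<open>Complexifying a real inverse gives the complex inverse, so the hypothesis on the
  transfer function can be evaluated at real points with real matrices alone.\<close>

lemma transfer_function_of_real:
  assumes "(mat s - A) ** N = mat 1" "N ** (mat s - A) = mat 1"
  shows "resolvent_defined A (complex_of_real s)"
    and "transfer_function A B C D (complex_of_real s) = complex_matrix (C ** N ** B + D)"
proof -
  have diff: "complex_matrix (mat s - A) = mat (complex_of_real s) - complex_matrix A"
    by (simp add: map_matrix_def mat_def vec_eq_iff)
  have "(mat (complex_of_real s) - complex_matrix A) ** complex_matrix N = mat 1"
    "complex_matrix N ** (mat (complex_of_real s) - complex_matrix A) = mat 1"
    by (simp_all add: diff[symmetric] complex_matrix_mult[symmetric] assms complex_matrix_mat)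
  then show "resolvent_defined A (complex_of_real s)"
    and "transfer_function A B C D (complex_of_real s) = complex_matrix (C ** N ** B + D)"
    using matrix_inv_eqI[of "mat (complex_of_real s) - complex_matrix A" "complex_matrix N"]
    by (auto simp: resolvent_defined_def invertible_def transfer_function_def
        complex_matrix_mult complex_matrix_add)
qed

lemma mat_vector_mult: "mat r *v x = r *\<^sub>R (x :: real^'n::finite)"
  by (simp add: mat_def matrix_vector_mult_def vec_eq_iff if_distrib[where f = "\<lambda>u. u * _"] cong: if_cong)

text \<open>For \<open>s\<close> beyond the operator norm of \<open>A\<close>, the matrix
  \<open>mat s - A\<close> is bounded below by \<open>s\<close> minus that norm, hence invertible;
  \<open>x\<close> is its inverse applied to \<open>B *v w\<close>.\<close>

lemma resolvent_vector:
  fixes A :: "real^'n::finite^'n" and B :: "real^'m::finite^'n"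
    and C :: "real^'n^'h::finite" and D :: "real^'m^'h"
  assumes "\<And>s. resolvent_defined A s \<Longrightarrow> transfer_function A B C D s = 0"
    and s: "s > onorm ((*v) A)"
  shows "\<exists>x. s *\<^sub>R x = A *v x + B *v w \<and> C *v x + D *v w = 0 \<and>
    norm x \<le> norm (B *v w) / (s - onorm ((*v) A))"
proof -
  have bound: "(s - onorm ((*v) A)) * norm x \<le> norm ((mat s - A) *v x)" for x
  proof -
    have "norm (A *v x) \<le> onorm ((*v) A) * norm x"
      by (rule onorm) simp
    moreover have "norm (s *\<^sub>R x) - norm (A *v x) \<le> norm (s *\<^sub>R x - A *v x)"
      by (rule norm_triangle_ineq2)
    moreover have "s * norm x \<le> norm (s *\<^sub>R x)"
      by (simp add: mult_right_mono)
    ultimately show ?thesis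
      by (simp add: matrix_vector_mult_diff_rdistrib mat_vector_mult left_diff_distrib)
  qed
  have "x = 0" if "(mat s - A) *v x = 0" for x
    using bound[of x] that s by (simp add: mult_le_0_iff)
  then obtain N where N: "N ** (mat s - A) = mat 1"
    using matrix_left_invertible_ker[of "mat s - A"] by blast
  then have N': "(mat s - A) ** N = mat 1" using matrix_left_right_inverse by blast
  have "complex_matrix (C ** N ** B + D) = 0"
    using transfer_function_of_real[OF N' N] assms(1) by metis
  then have "C ** N ** B + D = 0"
    by (simp add: map_matrix_def vec_eq_iff flip: of_real_add)
  then have out: "C *v (N *v (B *v w)) + D *v w = 0"
    by (metis matrix_vector_mul_assoc matrix_vector_mult_0 matrix_vector_mult_add_rdistrib)
  have eq: "(mat s - A) *v (N *v (B *v w)) = B *v w"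
    by (metis N' matrix_vector_mul_assoc matrix_vector_mul_lid)
  then have "s *\<^sub>R (N *v (B *v w)) = A *v (N *v (B *v w)) + B *v w"
    by (simp add: matrix_vector_mult_diff_rdistrib mat_vector_mult algebra_simps)
  moreover have "norm (N *v (B *v w)) \<le> norm (B *v w) / (s - onorm ((*v) A))"
    using bound[of "N *v (B *v w)"] eq s by (simp add: field_simps)
  ultimately show ?thesis using out by blast
qed

text \<open>
  With \<open>R s\<close> the resolvent, \<open>s R s = I + A R s\<close>; so if \<open>C A\<^sup>k R s B = 0\<close> for all large \<open>s\<close>, then
  \<open>C A\<^sup>k B + C A\<^sup>k\<^sup>+\<^sup>1 R s B = 0\<close>, and letting \<open>s\<close> tend to infinity gives \<open>C A\<^sup>k B = 0\<close>.
\<close>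

lemma transfer_function_zero:
  fixes A :: "real^'n::finite^'n" and B :: "real^'m::finite^'n"
    and C :: "real^'n^'h::finite" and D :: "real^'m^'h"
  assumes "\<And>s. resolvent_defined A s \<Longrightarrow> transfer_function A B C D s = 0"
  shows "D *v w = 0" and "C *v (((*v) A ^^ k) (B *v w)) = 0"
proof -
  define a where "a = onorm ((*v) A)"
  have "\<exists>x. s *\<^sub>R x = A *v x + B *v w \<and> C *v x + D *v w = 0 \<and>
      norm x \<le> norm (B *v w) / (s - a)" if "s > a" for s
    using resolvent_vector[of A B C D s w] assms that unfolding a_def by blast
  then obtain x where x: "\<And>s. s > a \<Longrightarrow> s *\<^sub>R x s = A *v x s + B *v w"
      "\<And>s. s > a \<Longrightarrow> C *v x s + D *v w = 0"
      "\<And>s. s > a \<Longrightarrow> norm (x s) \<le> norm (B *v w) / (s - a)"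
    by metis
  have "((\<lambda>s. norm (B *v w) / (s - a)) \<longlongrightarrow> 0) at_top"
    by (intro tendsto_divide_0[OF tendsto_const] filterlim_at_top_imp_at_infinity
        filterlim_tendsto_add_at_top[OF tendsto_const filterlim_ident, of "- a", simplified])
  then have x0: "(x \<longlongrightarrow> 0) at_top"
    by (rule Lim_null_comparison[rotated])
       (use x(3) in \<open>auto intro: eventually_mono[OF eventually_gt_at_top[of a]]\<close>)
  have lim: "((\<lambda>s. f (x s)) \<longlongrightarrow> 0) at_top" if "linear f" for f :: "real^'n \<Rightarrow> real^'h"
    using linear_continuous_at[of f 0] that x0
    by (metis isCont_tendsto_compose linear_0 linear_conv_bounded_linear)
  \<comment> \<open>\<open>f (x s)\<close> tends to 0, so in the limit an identity valid for all
    large \<open>s\<close> retains only its constant term.\<close>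
  have const_zero: "b = 0" if "linear f" "\<And>s. s > a \<Longrightarrow> f (x s) + b = 0"
    for f :: "real^'n \<Rightarrow> real^'h" and b
  proof -
    have "((\<lambda>s. f (x s) + b) \<longlongrightarrow> 0 + b) at_top"
      by (intro tendsto_intros lim that)
    moreover have "((\<lambda>s. f (x s) + b) \<longlongrightarrow> 0) at_top"
      by (rule tendsto_eventually)
         (use that(2) in \<open>auto intro: eventually_mono[OF eventually_gt_at_top[of a]]\<close>)
    ultimately show ?thesis
      using tendsto_unique trivial_limit_at_top_linorder by fastforce
  qed
  show D: "D *v w = 0"
    by (rule const_zero[of "(*v) C"]) (simp_all add: x)
  have lin: "linear (\<lambda>y. C *v (((*v) A ^^ k) y))" for k
    using linear_compose[OF linear_matrix_iterate[of k A] matrix_vector_mul_linear[of C]]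
    by (simp add: o_def)
  have step: "C *v (((*v) A ^^ Suc k) (x s)) + C *v (((*v) A ^^ k) (B *v w)) = 0"
    if "C *v (((*v) A ^^ k) (x s)) = 0" "s > a" for s k
  proof -
    have "C *v (((*v) A ^^ k) (A *v x s + B *v w)) = s *\<^sub>R (C *v (((*v) A ^^ k) (x s)))"
      using linear_scale[OF lin[of k], of s "x s"] x(1)[OF that(2)] by simp
    then show ?thesis
      using that(1) linear_add[OF lin[of k]] by (simp add: funpow_swap1)
  qed
  \<comment> \<open>Once the claim holds for \<open>k\<close>, \<open>step\<close> and the limit
    annihilate the constant term \<open>C A^k B w\<close>, and \<open>step\<close> then yields the
    claim for \<open>Suc k\<close>. The start uses \<open>D *v w = 0\<close>.\<close>
  have ind: "\<forall>s>a. C *v (((*v) A ^^ k) (x s)) = 0" for k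
  proof (induction k)
    case 0
    then show ?case using x(2) D by simp
  next
    case (Suc k)
    then have "C *v (((*v) A ^^ k) (B *v w)) = 0"
      using const_zero[OF lin[of "Suc k"]] step by blast
    then show ?case using Suc step by (metis add.right_neutral)
  qed
  show "C *v (((*v) A ^^ k) (B *v w)) = 0"
    using const_zero[OF lin[of "Suc k"]] step ind by blast
qed

lemma output_zero_on_controllable_subspace:
  fixes A :: "real^'n::finite^'n" and B :: "real^'m::finite^'n"
    and C :: "real^'n^'h::finite" and D :: "real^'m^'h"
  assumes "\<And>s. resolvent_defined A s \<Longrightarrow> transfer_function A B C D s = 0"
    and "x \<in> controllable_subspace A B"
  shows "C *v x = 0"
proof -
  obtain w where "x = (\<Sum>k<CARD('n). (((*v) A) ^^ k) (B *v w k))"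
    using assms(2) unfolding controllable_subspace_eq by blast
  then show ?thesis
    by (simp add: linear_sum[OF matrix_vector_mul_linear] transfer_function_zero(2)[OF assms(1)])
qed

text \<open>By superposition it suffices to steer each summand \<open>A^k B w k\<close> separately,
  with a scalar input acting along \<open>B *v w k\<close>.\<close>

lemma controllable_state_steering:
  fixes A :: "real^'n::finite^'n" and B :: "real^'m::finite^'n"
  assumes "x0 \<in> controllable_subspace A B" "T \<noteq> 0"
  shows "\<exists>x u. x 0 = x0 \<and> x T = 0 \<and> continuous_on UNIV u \<and>
    (\<forall>t. (x has_vector_derivative A *v x t + B *v u t) (at t)) \<and>
    (\<forall>t. x t \<in> controllable_subspace A B)"
proof -
  define n where "n = CARD('n)"
  obtain w where w: "x0 = (\<Sum>k<n. (((*v) A) ^^ k) (B *v w k))"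
    using assms(1) unfolding controllable_subspace_eq n_def by blast
  have "\<exists>x u. x 0 = (((*v) A) ^^ k) (B *v w k) \<and> x T = 0 \<and> continuous_on UNIV u \<and>
      (\<forall>t. (x has_vector_derivative A *v x t + u t *\<^sub>R (B *v w k)) (at t)) \<and>
      (\<forall>t. x t \<in> controllable_subspace A B)" if "k < n" for k
  proof -
    obtain c where "(((*v) A) ^^ n) (B *v w k) =
        (\<Sum>j<n. c j *\<^sub>R (((*v) A) ^^ j) (B *v w k))"
      using Krylov_dependence[of "(*v) A" "B *v w k"] by (auto simp: n_def)
    note Krylov_steering[OF matrix_vector_mul_linear assms(2) this,
        of "\<lambda>j. if j = k then 1 else 0"]
    moreover have "(\<Sum>j<n. (if j = k then 1 else 0) *\<^sub>R (((*v) A) ^^ j) (B *v w k)) =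
        (((*v) A) ^^ k) (B *v w k)"
    proof -
      have "(\<Sum>j<n. (if j = k then 1 else 0) *\<^sub>R (((*v) A) ^^ j) (B *v w k)) =
          (\<Sum>j<n. if j = k then (((*v) A) ^^ j) (B *v w k) else 0)"
        by (intro sum.cong) auto
      then show ?thesis using that by simp
    qed
    moreover have "span (range (\<lambda>j. (((*v) A) ^^ j) (B *v w k))) \<subseteq> controllable_subspace A B"
      by (rule span_minimal)
         (auto simp: iterate_in_controllable_subspace subspace_controllable_subspace)
    ultimately show ?thesis by (smt (verit) subsetD)
  qed
  then obtain x u where
      xu: "\<And>k. k < n \<Longrightarrow> x k 0 = (((*v) A) ^^ k) (B *v w k)"
        "\<And>k. k < n \<Longrightarrow> x k T = 0" "\<And>k. k < n \<Longrightarrow> continuous_on UNIV (u k)"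
        "\<And>k t. k < n \<Longrightarrow> (x k has_vector_derivative A *v x k t + u k t *\<^sub>R (B *v w k)) (at t)"
        "\<And>k t. k < n \<Longrightarrow> x k t \<in> controllable_subspace A B"
    by metis
  define X where "X t = (\<Sum>k<n. x k t)" for t :: real
  define U where "U t = (\<Sum>k<n. u k t *\<^sub>R w k)" for t :: real
  have "(X has_vector_derivative A *v X t + B *v U t) (at t)" for t
  proof -
    have "(X has_vector_derivative (\<Sum>k<n. A *v x k t + u k t *\<^sub>R (B *v w k))) (at t)"
      unfolding X_def by (rule has_vector_derivative_sum) (simp add: xu)
    also have "(\<Sum>k<n. A *v x k t + u k t *\<^sub>R (B *v w k)) = A *v X t + B *v U t"
      by (simp add: X_def U_def sum.distrib linear_sum[OF matrix_vector_mul_linear]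
          matrix_vector_mult_scaleR)
    finally show ?thesis .
  qed
  moreover have "X 0 = x0" "X T = 0" by (simp_all add: X_def w xu)
  moreover have "continuous_on UNIV U"
    unfolding U_def by (intro continuous_intros xu) auto
  moreover have "X t \<in> controllable_subspace A B" for t
    unfolding X_def by (intro subspace_sum subspace_controllable_subspace xu) auto
  ultimately show ?thesis by blast
qed

section \<open>Energy estimates\<close>

lemma set_integral_linear:
  fixes f :: "'b \<Rightarrow> 'a::euclidean_space" and F :: "'a \<Rightarrow> 'c::euclidean_space"
  assumes "linear F" "set_integrable M X f"
  shows "set_integrable M X (\<lambda>s. F (f s))"
    and "(LINT s:X|M. F (f s)) = F (LINT s:X|M. f s)"
proof -
  have bl: "bounded_linear F" using assms(1) by (simp add: linear_conv_bounded_linear)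
  have eq: "indicator X s *\<^sub>R F (f s) = F (indicator X s *\<^sub>R f s)" for s
    by (simp add: linear_scale[OF assms(1)])
  show "set_integrable M X (\<lambda>s. F (f s))"
    using integrable_bounded_linear[OF bl] assms(2) by (simp add: set_integrable_def eq)
  show "(LINT s:X|M. F (f s)) = F (LINT s:X|M. f s)"
    using integral_bounded_linear[OF bl] assms(2)
    by (simp add: set_integrable_def set_lebesgue_integral_def eq)
qed

text \<open>On a bounded interval constants are integrable, and \<open>r \<le> 1 + r\<^sup>2\<close>
  gives domination.\<close>

lemma L2_on_imp_set_integrable:
  fixes f :: "real \<Rightarrow> 'a::euclidean_space"
  assumes "L2_on {a..b} f"
  shows "set_integrable lebesgue {a..b} f"
proof (rule set_integrable_bound)
  show "set_integrable lebesgue {a..b} (\<lambda>t. 1 + (norm (f t))\<^sup>2)"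
    using assms
    by (intro set_integral_add(1) absolutely_integrable_continuous_real[OF continuous_on_const])
      (simp add: L2_on_def)
  show "set_borel_measurable lebesgue {a..b} f"
    using assms by (simp add: L2_on_def)
  have "r \<le> 1 + r\<^sup>2" for r :: real
    using zero_le_power2[of "r - 1/2"] by (simp add: power2_eq_square algebra_simps)
  then show "AE x in lebesgue. x \<in> {a..b} \<longrightarrow> norm (f x) \<le> norm (1 + (norm (f x))\<^sup>2)"
    by (intro AE_I2) auto
qed

lemma continuous_imp_L2_on:
  fixes f :: "real \<Rightarrow> 'a::euclidean_space"
  assumes "continuous_on {a..b} f"
  shows "L2_on {a..b} f"
proof -
  have "set_integrable lebesgue {a..b} f" "set_integrable lebesgue {a..b} (\<lambda>t. (norm (f t))\<^sup>2)"
    using assms by (auto intro!: absolutely_integrable_continuous_real continuous_intros)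
  then show ?thesis
    by (auto simp: L2_on_def set_borel_measurable_def set_integrable_def)
qed

text \<open>Obtained by integrating the nonnegative square of \<open>norm (f t) - J / T\<close>; the
  mean \<open>J / T\<close> of the norm is the optimal constant to subtract.\<close>

lemma set_integral_Cauchy_Schwarz:
  fixes f :: "real \<Rightarrow> 'a::euclidean_space"
  assumes "L2_on {0..T} f" "T > 0"
  shows "(LINT t:{0..T}|lebesgue. norm (f t))\<^sup>2 \<le> T * (LINT t:{0..T}|lebesgue. (norm (f t))\<^sup>2)"
proof -
  define J where "J = (LINT t:{0..T}|lebesgue. norm (f t))"
  have int: "set_integrable lebesgue {0..T} (\<lambda>t. norm (f t))"
    by (intro set_integrable_norm L2_on_imp_set_integrable assms)
  have int2: "set_integrable lebesgue {0..T} (\<lambda>t. (norm (f t))\<^sup>2)"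
    using assms by (simp add: L2_on_def)
  have int3: "set_integrable lebesgue {0..T} (\<lambda>t. J\<^sup>2 / T\<^sup>2)"
    by (intro absolutely_integrable_continuous_real continuous_intros)
  have "(LINT t:{0..T}|lebesgue. (2 * J / T) * norm (f t)) \<le>
      (LINT t:{0..T}|lebesgue. (norm (f t))\<^sup>2 + J\<^sup>2 / T\<^sup>2)"
  proof (intro set_integral_mono set_integrable_mult_right set_integral_add int int2 int3)
    fix t
    show "(2 * J / T) * norm (f t) \<le> (norm (f t))\<^sup>2 + J\<^sup>2 / T\<^sup>2"
      using zero_le_power2[of "norm (f t) - J / T"]
      by (simp add: power2_diff power_divide mult_ac)
  qed
  also have "\<dots> = (LINT t:{0..T}|lebesgue. (norm (f t))\<^sup>2) + J\<^sup>2 / T"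
    using assms(2) by (subst set_integral_add(2)[OF int2 int3], subst set_integral_const)
      (auto simp: power2_eq_square)
  also have "(LINT t:{0..T}|lebesgue. (2 * J / T) * norm (f t)) = 2 * (J\<^sup>2 / T)"
    by (simp add: J_def power2_eq_square)
  finally show ?thesis
    using assms(2) unfolding J_def[symmetric] by (simp add: field_simps)
qed

text \<open>The state enters through its supremum bound and \<open>\<xi>\<close> only through its L1
  norm. The pointwise bound is nonnegative, so the interval of integration may be enlarged from
  \<open>t\<close> to \<open>T\<close>.\<close>

lemma set_integral_linear_drift_bound:
  fixes p :: "real \<Rightarrow> 'a::euclidean_space" and \<xi> :: "real \<Rightarrow> 'b::euclidean_space"
    and F :: "'a \<Rightarrow> 'c::euclidean_space" and G :: "'b \<Rightarrow> 'c"
  assumes "linear F" "linear G"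
    and F: "\<And>x. norm (F x) \<le> a * norm x" "a \<ge> 0" and G: "\<And>w. norm (G w) \<le> b * norm w" "b \<ge> 0"
    and p: "continuous_on {0..T} p" "\<And>s. s \<in> {0..T} \<Longrightarrow> norm (p s) \<le> m"
    and \<xi>: "set_integrable lebesgue {0..T} \<xi>" and t: "t \<in> {0..T}"
  shows "norm (LINT s:{0..t}|lebesgue. F (p s) + G (\<xi> s)) \<le>
    T * a * m + b * (LINT s:{0..T}|lebesgue. norm (\<xi> s))"
proof -
  have m: "m \<ge> 0" using p(2)[OF t] norm_ge_zero order_trans by blast
  have const: "set_integrable lebesgue {0..T} (\<lambda>_. a * m)"
    by (intro absolutely_integrable_continuous_real continuous_intros)
  have norm_\<xi>: "set_integrable lebesgue {0..T} (\<lambda>s. b * norm (\<xi> s))"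
    by (intro set_integrable_mult_right set_integrable_norm \<xi>)
  have bnd: "set_integrable lebesgue {0..T} (\<lambda>s. a * m + b * norm (\<xi> s))"
    by (intro set_integral_add const norm_\<xi>)
  have "set_integrable lebesgue {0..T} (\<lambda>s. F (p s) + G (\<xi> s))"
    by (rule set_integral_add(1)[OF set_integral_linear(1)[OF \<open>linear F\<close>
          absolutely_integrable_continuous_real[OF p(1)]] set_integral_linear(1)[OF \<open>linear G\<close> \<xi>]])
  then have drift: "set_integrable lebesgue {0..t} (\<lambda>s. F (p s) + G (\<xi> s))"
    by (rule set_integrable_subset) (use t in auto)
  have "norm (LINT s:{0..t}|lebesgue. F (p s) + G (\<xi> s)) \<le>
      (LINT s:{0..t}|lebesgue. norm (F (p s) + G (\<xi> s)))"
    by (rule set_integral_norm_bound[OF drift])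
  also have "\<dots> \<le> (LINT s:{0..t}|lebesgue. a * m + b * norm (\<xi> s))"
  proof (rule set_integral_mono)
    show "set_integrable lebesgue {0..t} (\<lambda>s. norm (F (p s) + G (\<xi> s)))"
      by (rule set_integrable_norm[OF drift])
    show "set_integrable lebesgue {0..t} (\<lambda>s. a * m + b * norm (\<xi> s))"
      by (rule set_integrable_subset[OF bnd]) (use t in auto)
  next
    fix s assume "s \<in> {0..t}"
    then have "norm (p s) \<le> m" using p(2) t by auto
    then have "a * norm (p s) \<le> a * m" using F(2) by (rule mult_left_mono)
    then show "norm (F (p s) + G (\<xi> s)) \<le> a * m + b * norm (\<xi> s)"
      using F(1)[of "p s"] G(1)[of "\<xi> s"] norm_triangle_ineq[of "F (p s)" "G (\<xi> s)"] by linarith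
  qed
  also have "\<dots> \<le> (LINT s:{0..T}|lebesgue. a * m + b * norm (\<xi> s))"
    unfolding set_lebesgue_integral_def
  proof (rule integral_mono)
    show "integrable lebesgue (\<lambda>s. indicat_real {0..t} s *\<^sub>R (a * m + b * norm (\<xi> s)))"
      using set_integrable_subset[OF bnd, of "{0..t}"] t by (auto simp: set_integrable_def)
    show "integrable lebesgue (\<lambda>s. indicat_real {0..T} s *\<^sub>R (a * m + b * norm (\<xi> s)))"
      using bnd by (simp add: set_integrable_def)
    show "indicat_real {0..t} s *\<^sub>R (a * m + b * norm (\<xi> s)) \<le>
        indicat_real {0..T} s *\<^sub>R (a * m + b * norm (\<xi> s))" for s
      using t F(2) G(2) m by (auto simp: indicator_def)
  qed
  also have "\<dots> = T * a * m + b * (LINT s:{0..T}|lebesgue. norm (\<xi> s))"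
    using t by (subst set_integral_add(2)[OF const norm_\<xi>], subst set_integral_const) auto
  finally show ?thesis .
qed

text \<open>
  \<open>P\<close> is meant to be a projection whose kernel is the controllable subspace: \<open>P x\<close> solves a
  linear equation that is driven by \<open>\<xi>\<close> alone, and it determines the uncertainty output.
\<close>

lemma projected_trajectory_estimates:
  fixes S :: "('n::finite, 'm::finite, 'r::finite, 'h::finite, 'l::finite) uncertain_system"
    and P :: "real^'n \<Rightarrow> real^'n"
  assumes P: "linear P" "\<And>x. P (sysA S *v P x) = P (sysA S *v x)" "\<And>w. P (sysB1 S *v w) = 0"
    and out: "\<And>x. sysC1 S *v P x = sysC1 S *v x" "\<And>w. sysD1 S *v w = 0"
    and a: "\<And>x. norm (P (sysA S *v x)) \<le> a * norm x" "a \<ge> 0"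
    and b: "\<And>w. norm (P (sysB2 S *v w)) \<le> b * norm w" "b \<ge> 0"
    and c: "\<And>x. norm (sysC1 S *v x) \<le> c * norm x" "c \<ge> 0"
    and T: "T > 0" "T * a \<le> 1 / 2"
    and L2: "L2_on {0..T} u" "L2_on {0..T} \<xi>" and traj: "state_trajectory S T x0 u \<xi> x"
  defines "I \<equiv> LINT t:{0..T}|lebesgue. (norm (\<xi> t))\<^sup>2"
  shows "\<exists>M. M \<le> 8 * (norm (P x0))\<^sup>2 + 8 * b\<^sup>2 * T * I \<and>
    (norm (P x0))\<^sup>2 \<le> 3 * (norm (P (x T)))\<^sup>2 + 3 * (T * a)\<^sup>2 * M + 3 * b\<^sup>2 * T * I \<and>
    I - T * c\<^sup>2 * M \<le>
      (LINT t:{0..T}|lebesgue. (norm (\<xi> t))\<^sup>2 - (norm (uncertainty_output S x u t))\<^sup>2)"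
proof -
  define p where "p t = P (x t)" for t
  have cont_x: "continuous_on {0..T} x"
    and x: "\<And>t. t \<in> {0..T} \<Longrightarrow> x t = x0 +
        (LINT s:{0..t}|lebesgue. sysA S *v x s + sysB1 S *v u s + sysB2 S *v \<xi> s)"
    using traj by (auto simp: state_trajectory_def)
  have cont_p: "continuous_on {0..T} p"
    unfolding p_def using linear_continuous_on_compose[OF cont_x P(1)] by (simp add: o_def)
  define m where "m = (SUP t\<in>{0..T}. norm (p t))"
  have bdd: "bdd_above ((\<lambda>t. norm (p t)) ` {0..T})"
    by (intro bounded_imp_bdd_above compact_imp_bounded compact_continuous_image
        continuous_on_norm cont_p compact_Icc)
  have m: "norm (p t) \<le> m" if "t \<in> {0..T}" for t
    unfolding m_def using bdd that by (rule cSUP_upper2) simp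
  define J where "J = (LINT s:{0..T}|lebesgue. norm (\<xi> s))"
  have "J\<^sup>2 \<le> T * I"
    unfolding J_def I_def by (rule set_integral_Cauchy_Schwarz[OF L2(2) T(1)])
  then have J: "(b * J)\<^sup>2 \<le> b\<^sup>2 * T * I"
    by (simp add: power_mult_distrib mult.assoc mult_left_mono)
  have int_\<xi>: "set_integrable lebesgue {0..T} \<xi>" by (rule L2_on_imp_set_integrable[OF L2(2)])
  have drift: "norm (p t - P x0) \<le> T * a * m + b * J" if t: "t \<in> {0..T}" for t
  proof -
    have "set_integrable lebesgue {0..T} (\<lambda>s. sysA S *v x s + sysB1 S *v u s + sysB2 S *v \<xi> s)"
      by (intro set_integral_add(1) set_integral_linear(1)[OF matrix_vector_mul_linear]
          L2_on_imp_set_integrable[OF L2(1)] int_\<xi> absolutely_integrable_continuous_real[OF cont_x])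
    then have int: "set_integrable lebesgue {0..t}
        (\<lambda>s. sysA S *v x s + sysB1 S *v u s + sysB2 S *v \<xi> s)"
      by (rule set_integrable_subset) (use t in auto)
    have "p t - P x0 = P (LINT s:{0..t}|lebesgue. sysA S *v x s + sysB1 S *v u s + sysB2 S *v \<xi> s)"
      unfolding p_def x[OF t] linear_add[OF P(1)] by simp
    also have "\<dots> = (LINT s:{0..t}|lebesgue. P (sysA S *v x s + sysB1 S *v u s + sysB2 S *v \<xi> s))"
      by (rule set_integral_linear(2)[OF P(1) int, symmetric])
    \<comment> \<open>\<open>P\<close> annihilates the control term and sees the state only through
      \<open>P x\<close>, so the equation closes in \<open>p\<close>.\<close>
    also have "\<dots> = (LINT s:{0..t}|lebesgue. P (sysA S *v p s) + P (sysB2 S *v \<xi> s))"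
      by (simp add: linear_add[OF P(1)] P p_def)
    finally have eq: "p t - P x0 =
        (LINT s:{0..t}|lebesgue. P (sysA S *v p s) + P (sysB2 S *v \<xi> s))" .
    show ?thesis
      unfolding eq J_def
      by (rule set_integral_linear_drift_bound[where F = "\<lambda>y. P (sysA S *v y)" and G = "\<lambda>y. P (sysB2 S *v y)"])
         (use a b cont_p m int_\<xi> t linear_compose[OF matrix_vector_mul_linear P(1), unfolded o_def]
           in auto)
  qed
  have m0: "m \<ge> 0" using order_trans[OF norm_ge_zero m[of 0]] T(1) by simp
  have J0: "b * J \<ge> 0"
    unfolding J_def set_lebesgue_integral_def using b(2) by (intro mult_nonneg_nonneg integral_nonneg) auto
  have "norm (p t) \<le> norm (P x0) + m / 2 + b * J" if "t \<in> {0..T}" for t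
  proof -
    have "norm (p t) \<le> norm (P x0) + norm (p t - P x0)"
      using norm_triangle_sub[of "p t" "P x0"] by simp
    moreover have "T * a * m \<le> m / 2"
      using mult_right_mono[OF T(2) m0] by simp
    ultimately show ?thesis using drift[OF that] by linarith
  qed
  \<comment> \<open>Passing to the supremum; since \<open>T * a \<le> 1 / 2\<close>, half of
    \<open>m\<close> can be absorbed on the left.\<close>
  then have "m \<le> norm (P x0) + m / 2 + b * J"
    unfolding m_def using T(1) by (intro cSUP_least) auto
  then have "m \<le> 2 * (norm (P x0) + b * J)" by simp
  then have "m\<^sup>2 \<le> (2 * (norm (P x0) + b * J))\<^sup>2"
    using m0 by (rule power_mono)
  also have "\<dots> \<le> 8 * (norm (P x0))\<^sup>2 + 8 * (b * J)\<^sup>2"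
  proof -
    have "(2 * (r + s))\<^sup>2 \<le> 8 * r\<^sup>2 + 8 * s\<^sup>2" for r s :: real
      using zero_le_power2[of "r - s"] by (simp add: power2_eq_square algebra_simps)
    then show ?thesis .
  qed
  finally have 1: "m\<^sup>2 \<le> 8 * (norm (P x0))\<^sup>2 + 8 * b\<^sup>2 * T * I" using J by simp
  have "norm (P x0) \<le> norm (p T) + norm (p T - P x0)"
    using norm_triangle_sub[of "P x0" "p T"] by (simp add: norm_minus_commute)
  then have "norm (P x0) \<le> norm (p T) + T * a * m + b * J"
    using drift[of T] T(1) by simp
  then have "(norm (P x0))\<^sup>2 \<le> (norm (p T) + T * a * m + b * J)\<^sup>2"
    by (intro power_mono) auto
  also have "\<dots> \<le> 3 * (norm (p T))\<^sup>2 + 3 * (T * a * m)\<^sup>2 + 3 * (b * J)\<^sup>2"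
  proof -
    have "(r + s + t)\<^sup>2 \<le> 3 * r\<^sup>2 + 3 * s\<^sup>2 + 3 * t\<^sup>2" for r s t :: real
      using zero_le_power2[of "r - s"] zero_le_power2[of "r - t"] zero_le_power2[of "s - t"]
      by (simp add: power2_eq_square algebra_simps)
    then show ?thesis .
  qed
  finally have 2: "(norm (P x0))\<^sup>2 \<le>
      3 * (norm (P (x T)))\<^sup>2 + 3 * (T * a)\<^sup>2 * m\<^sup>2 + 3 * b\<^sup>2 * T * I"
    using J by (simp add: p_def power_mult_distrib)
  define z where "z t = sysC1 S *v p t" for t
  have z: "uncertainty_output S x u t = z t" for t
    by (simp add: uncertainty_output_def z_def p_def out)
  have cont_z: "continuous_on {0..T} z"
    unfolding z_def
    using linear_continuous_on_compose[OF cont_p matrix_vector_mul_linear[of "sysC1 S"]]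
    by (simp add: o_def)
  have int_\<xi>2: "set_integrable lebesgue {0..T} (\<lambda>t. (norm (\<xi> t))\<^sup>2)"
    using L2(2) by (simp add: L2_on_def)
  have int_z2: "set_integrable lebesgue {0..T} (\<lambda>t. (norm (z t))\<^sup>2)"
    using continuous_imp_L2_on[OF cont_z] by (simp add: L2_on_def)
  have "(LINT t:{0..T}|lebesgue. (norm (z t))\<^sup>2) \<le> (LINT t:{0..T}|lebesgue. c\<^sup>2 * m\<^sup>2)"
  proof (rule set_integral_mono[OF int_z2])
    show "set_integrable lebesgue {0..T} (\<lambda>t. c\<^sup>2 * m\<^sup>2)"
      by (intro absolutely_integrable_continuous_real continuous_intros)
    fix t assume "t \<in> {0..T}"
    then have "norm (z t) \<le> c * m"
      unfolding z_def using c(1)[of "p t"] mult_left_mono[OF m c(2)] order_trans by blast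
    then show "(norm (z t))\<^sup>2 \<le> c\<^sup>2 * m\<^sup>2"
      using power_mono[of "norm (z t)" "c * m" 2] by (simp add: power_mult_distrib)
  qed
  also have "\<dots> = T * c\<^sup>2 * m\<^sup>2"
    using T(1) by (subst set_integral_const) auto
  finally have 3: "I - T * c\<^sup>2 * m\<^sup>2 \<le>
      (LINT t:{0..T}|lebesgue. (norm (\<xi> t))\<^sup>2 - (norm (uncertainty_output S x u t))\<^sup>2)"
    unfolding z set_integral_diff(2)[OF int_\<xi>2 int_z2] I_def by simp
  show ?thesis using 1 2 3 by blast
qed

text \<open>
  Write \<open>M\<close>, \<open>I\<close>, \<open>X\<close> for the averages of the squared supremum of \<open>P x\<close>, of the energy of \<open>\<xi>\<close>
  and of the squared norm of \<open>P x(T)\<close>. The constraint gives \<open>I \<le> d + T c\<^sup>2 M\<close>, and for small \<open>T\<close>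
  the previous estimates can then be solved for the norm of \<open>P x0\<close>.
\<close>

lemma projected_initial_state_bound:
  fixes S :: "('n::finite, 'm::finite, 'r::finite, 'h::finite, 'l::finite) uncertain_system"
    and P :: "real^'n \<Rightarrow> real^'n"
  assumes P: "linear P" "\<And>x. P (sysA S *v P x) = P (sysA S *v x)" "\<And>w. P (sysB1 S *v w) = 0"
    and out: "\<And>x. sysC1 S *v P x = sysC1 S *v x" "\<And>w. sysD1 S *v w = 0"
    and a: "\<And>x. norm (P (sysA S *v x)) \<le> a * norm x" "a \<ge> 0"
    and b: "\<And>w. norm (P (sysB2 S *v w)) \<le> b * norm w" "b \<ge> 0"
    and c: "\<And>x. norm (sysC1 S *v x) \<le> c * norm x" "c \<ge> 0"
    and T: "T > 0" "96 * T\<^sup>2 * (a\<^sup>2 + b\<^sup>2 * c\<^sup>2) \<le> 1"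
    and adm: "admissible S d T x0 q u \<xi> x" and "d > 0"
  shows "(norm (P x0))\<^sup>2 \<le> 6 * ((1 / real q) * (\<Sum>i=1..q. (norm (P (x i T)))\<^sup>2)) + 7 * b\<^sup>2 * T * d"
proof -
  define N where "N = (norm (P x0))\<^sup>2"
  define I where "I i = (LINT t:{0..T}|lebesgue. (norm (\<xi> i t))\<^sup>2)" for i
  define W where "W i = (LINT t:{0..T}|lebesgue.
      (norm (\<xi> i t))\<^sup>2 - (norm (uncertainty_output S (x i) (u i) t))\<^sup>2)" for i
  have q: "q \<ge> 1" and W: "(1 / real q) * (\<Sum>i=1..q. W i) \<le> d"
    and tr: "\<And>i. i \<in> {1..q} \<Longrightarrow> L2_on {0..T} (u i) \<and> L2_on {0..T} (\<xi> i) \<and>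
        state_trajectory S T x0 (u i) (\<xi> i) (x i)"
    using adm by (auto simp: admissible_def W_def)
  have Ta: "96 * (T * a)\<^sup>2 + 96 * (T\<^sup>2 * b\<^sup>2 * c\<^sup>2) \<le> 1"
    using T(2) by (simp add: power_mult_distrib algebra_simps)
  moreover have "0 \<le> T\<^sup>2 * b\<^sup>2 * c\<^sup>2" by simp
  ultimately have "(T * a)\<^sup>2 \<le> 1 / 4" using zero_le_power2[of "T * a"] by linarith
  also have "1 / 4 = (1 / 2 :: real)\<^sup>2" by (simp add: power_divide)
  finally have Ta2: "T * a \<le> 1 / 2" by (rule power2_le_imp_le) simp
  have "\<exists>M. M \<le> 8 * N + 8 * b\<^sup>2 * T * I i \<and>
      N \<le> 3 * (norm (P (x i T)))\<^sup>2 + 3 * (T * a)\<^sup>2 * M + 3 * b\<^sup>2 * T * I i \<and>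
      I i - T * c\<^sup>2 * M \<le> W i" if "i \<in> {1..q}" for i
    using projected_trajectory_estimates[OF P out a b c T(1) Ta2, of "u i" "\<xi> i" x0 "x i"] tr[OF that]
    unfolding N_def I_def W_def by blast
  then obtain M where M: "\<And>i. i \<in> {1..q} \<Longrightarrow> M i \<le> 8 * N + 8 * b\<^sup>2 * T * I i"
      "\<And>i. i \<in> {1..q} \<Longrightarrow> N \<le> 3 * (norm (P (x i T)))\<^sup>2 + 3 * (T * a)\<^sup>2 * M i + 3 * b\<^sup>2 * T * I i"
      "\<And>i. i \<in> {1..q} \<Longrightarrow> I i - T * c\<^sup>2 * M i \<le> W i"
    by metis
  define avg where "avg f = (1 / real q) * (\<Sum>i=1..q. f i)" for f :: "nat \<Rightarrow> real"
  have avg_mono: "avg f \<le> avg g" if "\<And>i. i \<in> {1..q} \<Longrightarrow> f i \<le> g i" for f g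
    unfolding avg_def by (intro mult_left_mono sum_mono that) auto
  have avg_add: "avg (\<lambda>i. f i + g i) = avg f + avg g" for f g
    by (simp add: avg_def sum.distrib algebra_simps)
  have avg_diff: "avg (\<lambda>i. f i - g i) = avg f - avg g" for f g
    by (simp add: avg_def sum_subtractf algebra_simps)
  have avg_mult: "avg (\<lambda>i. k * f i) = k * avg f" for k f
    by (simp add: avg_def sum_distrib_left)
  have avg_const: "avg (\<lambda>i. k) = k" for k
    using q by (simp add: avg_def)
  note avg = avg_add avg_diff avg_mult avg_const
  define X where "X = avg (\<lambda>i. (norm (P (x i T)))\<^sup>2)"
  have M1: "avg M \<le> 8 * N + 8 * b\<^sup>2 * T * avg I"
    using avg_mono[OF M(1)] by (simp add: avg)
  have M2: "N \<le> 3 * X + 3 * (T * a)\<^sup>2 * avg M + 3 * b\<^sup>2 * T * avg I"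
    using avg_mono[OF M(2)] by (simp add: avg X_def)
  have "avg I - T * c\<^sup>2 * avg M \<le> avg W"
    using avg_mono[OF M(3)] by (simp add: avg)
  then have "avg I \<le> d + T * c\<^sup>2 * avg M"
    using W unfolding avg_def[symmetric] by linarith
  then have "b\<^sup>2 * T * avg I \<le> b\<^sup>2 * T * (d + T * c\<^sup>2 * avg M)"
    using T(1) by (intro mult_left_mono) auto
  also have "\<dots> = b\<^sup>2 * T * d + T\<^sup>2 * b\<^sup>2 * c\<^sup>2 * avg M"
    by (simp add: power2_eq_square algebra_simps)
  finally have I1: "b\<^sup>2 * T * avg I \<le> b\<^sup>2 * T * d + T\<^sup>2 * b\<^sup>2 * c\<^sup>2 * avg M" .
  have d0: "b\<^sup>2 * T * d \<ge> 0" using T(1) \<open>d > 0\<close> by simp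
  have N0: "N \<ge> 0" by (simp add: N_def)
  define \<beta> where "\<beta> = T\<^sup>2 * b\<^sup>2 * c\<^sup>2"
  have \<beta>: "\<beta> \<ge> 0" "\<beta> \<le> 1 / 96 - (T * a)\<^sup>2" using Ta by (simp_all add: \<beta>_def)
  have N1: "N \<le> 6 * X + 7 * b\<^sup>2 * T * d"
  proof (cases "avg M \<ge> 0")
    case True
    \<comment> \<open>Write \<open>D = b\<^sup>2 * T * d\<close>. Here
      \<open>\<beta> \<le> 1 / 16\<close> gives \<open>avg M \<le> 16 * N + 16 * D\<close>, and the
      coefficient 96 makes \<open>3 * ((T * a)\<^sup>2 + \<beta>) * avg M \<le> avg M / 32 \<le> N /
      2 + D / 2\<close>. Hence \<open>N / 2 \<le> 3 * X + 7 / 2 * D\<close>, the source of the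
      factors 6 and 7.\<close>
    have "\<beta> \<le> 1 / 16" using \<beta>(2) zero_le_power2[of "T * a"] by linarith
    then have "\<beta> * avg M \<le> (1 / 16) * avg M" using True by (rule mult_right_mono)
    then have "avg M \<le> 16 * N + 16 * (b\<^sup>2 * T * d)"
      using M1 I1 unfolding \<beta>_def[symmetric] by linarith
    moreover have "((T * a)\<^sup>2 + \<beta>) * avg M \<le> (1 / 96) * avg M"
      using \<beta>(2) True by (intro mult_right_mono) linarith+
    then have "(T * a)\<^sup>2 * avg M + \<beta> * avg M \<le> (1 / 96) * avg M"
      by (simp add: distrib_right)
    ultimately show ?thesis using M2 I1 d0 unfolding \<beta>_def[symmetric] by linarith
  next
    case False
    then have "(T * a)\<^sup>2 * avg M \<le> 0" "\<beta> * avg M \<le> 0"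
      using \<beta>(1) by (auto simp: mult_le_0_iff)
    then show ?thesis using M2 I1 d0 N0 unfolding \<beta>_def[symmetric] by linarith
  qed
  then show ?thesis by (simp add: N_def X_def avg_def)
qed

section \<open>Possible controllability on a fixed horizon\<close>

lemma possibly_controllable_onE:
  assumes "possibly_controllable_on S T x0"
  obtains K where "K > 0" "\<And>d \<epsilon>. d > 0 \<Longrightarrow> \<epsilon> > 0 \<Longrightarrow>
    \<exists>q u \<xi> x. admissible S d T x0 q u \<xi> x \<and> averaged_cost \<epsilon> T q u x < K"
proof -
  define L where "L d \<epsilon> = (INF (q, u, \<xi>, x)\<in>{(q, u, \<xi>, x). admissible S d T x0 q u \<xi> x}.
      ereal (averaged_cost \<epsilon> T q u x))" for d \<epsilon>
  have "(SUP d\<in>{0<..}. SUP \<epsilon>\<in>{0<..}. L d \<epsilon>) < \<infinity>"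
    using assms by (simp add: possibly_controllable_on_def possible_controllability_function_def L_def)
  then obtain n :: nat where n: "(SUP d\<in>{0<..}. SUP \<epsilon>\<in>{0<..}. L d \<epsilon>) < ereal (real n)"
    using less_PInf_Ex_of_nat by auto
  \<comment> \<open>The added 1 keeps the bound positive even if \<open>n = 0\<close>. The infimum
    lies strictly below it, so some admissible sequence has smaller cost.\<close>
  have "\<exists>q u \<xi> x. admissible S d T x0 q u \<xi> x \<and> averaged_cost \<epsilon> T q u x < real n + 1"
    if "d > 0" "\<epsilon> > 0" for d \<epsilon>
  proof -
    have "L d \<epsilon> \<le> (SUP \<epsilon>\<in>{0<..}. L d \<epsilon>)" using that by (intro SUP_upper) auto
    also have "\<dots> \<le> (SUP d\<in>{0<..}. SUP \<epsilon>\<in>{0<..}. L d \<epsilon>)" using that by (intro SUP_upper) auto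
    also note n
    also have "ereal (real n) < ereal (real n + 1)" by simp
    finally show ?thesis unfolding L_def INF_less_iff by auto
  qed
  then show ?thesis using that[of "real n + 1"] by auto
qed

text \<open>With \<open>d\<close> and \<open>\<epsilon>\<close> both equal to \<open>e\<close>, the
  mean square of the final states and the slack of the constraint are of order \<open>e\<close>;
  letting \<open>e\<close> tend to 0 leaves \<open>P x0 = 0\<close>.\<close>

lemma possibly_controllable_imp_projection_zero:
  fixes S :: "('n::finite, 'm::finite, 'r::finite, 'h::finite, 'l::finite) uncertain_system"
    and P :: "real^'n \<Rightarrow> real^'n"
  assumes P: "linear P" "\<And>x. P (sysA S *v P x) = P (sysA S *v x)" "\<And>w. P (sysB1 S *v w) = 0"
    and out: "\<And>x. sysC1 S *v P x = sysC1 S *v x" "\<And>w. sysD1 S *v w = 0"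
    and a: "\<And>x. norm (P (sysA S *v x)) \<le> a * norm x" "a \<ge> 0"
    and b: "\<And>w. norm (P (sysB2 S *v w)) \<le> b * norm w" "b \<ge> 0"
    and c: "\<And>x. norm (sysC1 S *v x) \<le> c * norm x" "c \<ge> 0"
    and T: "T > 0" "96 * T\<^sup>2 * (a\<^sup>2 + b\<^sup>2 * c\<^sup>2) \<le> 1"
    and pc: "possibly_controllable_on S T x0"
  shows "P x0 = 0"
proof -
  obtain K where K: "K > 0" "\<And>d \<epsilon>. d > 0 \<Longrightarrow> \<epsilon> > 0 \<Longrightarrow>
      \<exists>q u \<xi> x. admissible S d T x0 q u \<xi> x \<and> averaged_cost \<epsilon> T q u x < K"
    using possibly_controllable_onE[OF pc] by metis
  obtain k where k: "k > 0" "\<And>x. norm (P x) \<le> k * norm x"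
    using linear_bounded_pos[OF P(1)] by (auto simp: mult.commute)
  have "(norm (P x0))\<^sup>2 \<le> (6 * k\<^sup>2 * K + 7 * b\<^sup>2 * T) * e" if e: "e > 0" for e
  proof -
    obtain q u \<xi> x where adm: "admissible S e T x0 q u \<xi> x" and cost: "averaged_cost e T q u x < K"
      using K(2)[OF e e] by blast
    have "(norm (P (x i T)))\<^sup>2 \<le> k\<^sup>2 * e * ((norm (x i T))\<^sup>2 / e +
        (LINT t:{0..T}|lebesgue. (norm (u i t))\<^sup>2))" for i
    proof -
      have "(norm (P (x i T)))\<^sup>2 \<le> (k * norm (x i T))\<^sup>2"
        by (intro power_mono k(2)) simp
      also have "\<dots> = k\<^sup>2 * e * ((norm (x i T))\<^sup>2 / e)"
        using e by (simp add: power_mult_distrib)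
      also have "\<dots> \<le> k\<^sup>2 * e * ((norm (x i T))\<^sup>2 / e + (LINT t:{0..T}|lebesgue. (norm (u i t))\<^sup>2))"
        using e unfolding set_lebesgue_integral_def
        by (intro mult_left_mono) (auto intro!: integral_nonneg)
      finally show ?thesis .
    qed
    then have "(1 / real q) * (\<Sum>i=1..q. (norm (P (x i T)))\<^sup>2) \<le>
        (1 / real q) * (\<Sum>i=1..q. k\<^sup>2 * e * ((norm (x i T))\<^sup>2 / e +
          (LINT t:{0..T}|lebesgue. (norm (u i t))\<^sup>2)))"
      by (intro mult_left_mono sum_mono) auto
    also have "\<dots> = k\<^sup>2 * e * averaged_cost e T q u x"
      by (simp add: averaged_cost_def sum_distrib_left)
    also have "\<dots> \<le> k\<^sup>2 * e * K" using cost e by (intro mult_left_mono) auto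
    finally have "(1 / real q) * (\<Sum>i=1..q. (norm (P (x i T)))\<^sup>2) \<le> k\<^sup>2 * e * K" .
    then have "(norm (P x0))\<^sup>2 \<le> 6 * (k\<^sup>2 * e * K) + 7 * b\<^sup>2 * T * e"
      using projected_initial_state_bound[OF P out a b c T adm e] by linarith
    then show ?thesis by (simp add: algebra_simps)
  qed
  moreover have "\<exists>e>0. C * e < r" if "r > 0" "C \<ge> 0" for C r :: real
    using that by (intro exI[of _ "r / (C + 1)"]) (auto simp: field_simps)
  moreover have "6 * k\<^sup>2 * K + 7 * b\<^sup>2 * T \<ge> 0" using K(1) T(1) by simp
  ultimately have "\<not> (norm (P x0))\<^sup>2 > 0" by (meson not_less)
  then show ?thesis by simp
qed

text \<open>A sequence of length 1 with \<open>\<xi> = 0\<close> suffices: the uncertainty output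
  vanishes, so the constraint holds for every \<open>d > 0\<close>, and \<open>x T = 0\<close>
  removes the term with \<open>\<epsilon>\<close>, leaving the energy of \<open>u\<close> as a
  common bound.\<close>

lemma steered_imp_possibly_controllable:
  fixes S :: "('n::finite, 'm::finite, 'r::finite, 'h::finite, 'l::finite) uncertain_system"
  assumes "T > 0" and x: "x 0 = x0" "x T = 0" and u: "continuous_on UNIV u"
    and ode: "\<And>t. (x has_vector_derivative sysA S *v x t + sysB1 S *v u t) (at t)"
    and out: "\<And>t. sysC1 S *v x t + sysD1 S *v u t = 0"
  shows "possibly_controllable_on S T x0"
proof -
  have cont_x: "continuous_on UNIV x"
    using ode by (auto intro!: continuous_at_imp_continuous_on has_vector_derivative_continuous)
  have traj: "state_trajectory S T x0 u (\<lambda>_. 0) x"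
    unfolding state_trajectory_def
  proof (intro conjI ballI)
    show "continuous_on {0..T} x" using cont_x continuous_on_subset by blast
    fix t assume t: "t \<in> {0..T}"
    have "((\<lambda>s. sysA S *v x s + sysB1 S *v u s) has_integral x t - x 0) {0..t}"
      by (rule fundamental_theorem_of_calculus)
         (use t ode in \<open>auto intro: has_vector_derivative_at_within\<close>)
    moreover have "set_integrable lebesgue {0..t} (\<lambda>s. sysA S *v x s + sysB1 S *v u s)"
    proof (rule absolutely_integrable_continuous_real, rule continuous_on_add)
      show "continuous_on {0..t} (\<lambda>s. sysA S *v x s)" "continuous_on {0..t} (\<lambda>s. sysB1 S *v u s)"
        using linear_continuous_on_compose[OF continuous_on_subset[OF cont_x subset_UNIV]
            matrix_vector_mul_linear[of "sysA S"]]
          linear_continuous_on_compose[OF continuous_on_subset[OF u subset_UNIV]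
            matrix_vector_mul_linear[of "sysB1 S"]] by (simp_all add: o_def)
    qed
    ultimately have "(LINT s:{0..t}|lebesgue. sysA S *v x s + sysB1 S *v u s) = x t - x 0"
      using set_lebesgue_integral_eq_integral(2) integral_unique by metis
    then show "x t = x0 + (LINT s:{0..t}|lebesgue. sysA S *v x s + sysB1 S *v u s + sysB2 S *v 0)"
      by (simp add: x(1))
  qed
  have L2: "L2_on {0..T} u" "L2_on {0..T} (\<lambda>_. 0 :: real^'r)"
    by (auto intro!: continuous_imp_L2_on continuous_on_subset[OF u])
  have adm: "admissible S d T x0 1 (\<lambda>_. u) (\<lambda>_ _. 0) (\<lambda>_. x)" if "d > 0" for d
    using that traj L2 by (simp add: admissible_def uncertainty_output_def out)
  define c where "c = (LINT t:{0..T}|lebesgue. (norm (u t))\<^sup>2)"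
  have cost: "averaged_cost \<epsilon> T 1 (\<lambda>_. u) (\<lambda>_. x) = c" for \<epsilon>
    by (simp add: averaged_cost_def x(2) c_def)
  have "possible_controllability_function S d x0 T \<le> ereal c" if "d > 0" for d
    unfolding possible_controllability_function_def
  proof (rule SUP_least)
    fix \<epsilon> :: real
    show "(INF (q, u, \<xi>, x)\<in>{(q, u, \<xi>, x). admissible S d T x0 q u \<xi> x}.
        ereal (averaged_cost \<epsilon> T q u x)) \<le> ereal c"
      by (rule INF_lower2[where i = "(1, \<lambda>_. u, \<lambda>_ _. 0, \<lambda>_. x)"])
         (simp_all only: mem_Collect_eq prod.case adm[OF that] cost order_refl)
  qed
  then have "(SUP d\<in>{0<..}. possible_controllability_function S d x0 T) \<le> ereal c"
    by (intro SUP_least) auto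
  then show ?thesis unfolding possibly_controllable_on_def by (rule le_less_trans) simp
qed

section \<open>Differential possible controllability\<close>

theorem theorem5:
  fixes S :: "('n::finite, 'm::finite, 'r::finite, 'h::finite, 'l::finite) uncertain_system"
    and x0 :: "real^'n"
  assumes H_zero: "\<And>s. resolvent_defined (sysA S) s \<Longrightarrow>
      transfer_function (sysA S) (sysB1 S) (sysC1 S) (sysD1 S) s = 0"
    and "x0 \<noteq> 0"
  shows "differentially_possibly_controllable S x0 \<longleftrightarrow>
    controllable_state (sysA S) (sysB1 S) x0"
proof
  let ?V = "controllable_subspace (sysA S) (sysB1 S)"
  note D1 = transfer_function_zero(1)[of "sysA S" "sysB1 S" "sysC1 S" "sysD1 S", OF H_zero]
  note C1 = output_zero_on_controllable_subspace[of "sysA S" "sysB1 S" "sysC1 S" "sysD1 S", OF H_zero]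
  {
    assume "differentially_possibly_controllable S x0"
    then obtain T0 where T0: "T0 > 0" "\<And>T. 0 < T \<Longrightarrow> T < T0 \<Longrightarrow> possibly_controllable_on S T x0"
      by (auto simp: differentially_possibly_controllable_def)
    obtain P where P: "linear P" "\<And>x. P x = 0 \<longleftrightarrow> x \<in> ?V" "\<And>x. x - P x \<in> ?V"
      using exists_projection_with_kernel[OF subspace_controllable_subspace] by metis
    have PA: "P (sysA S *v P x) = P (sysA S *v x)" for x
    proof -
      \<comment> \<open>\<open>x - P x\<close> lies in \<open>?V\<close>, which is invariant under
        \<open>sysA S\<close>.\<close>
      have "P (sysA S *v (x - P x)) = 0"
        by (simp only: P controllable_subspace_invariant)
      then show ?thesis by (simp add: matrix_vector_mult_diff_distrib linear_diff[OF P(1)])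
    qed
    have PB: "P (sysB1 S *v w) = 0" for w
      by (simp only: P input_in_controllable_subspace)
    have CP: "sysC1 S *v P x = sysC1 S *v x" for x
      using C1[OF _ P(3)[of x]] by (simp add: matrix_vector_mult_diff_distrib)
    have bounded: "\<exists>k\<ge>0. \<forall>x. norm (F x) \<le> k * norm x" if "linear F"
      for F :: "real^'i::finite \<Rightarrow> real^'j::finite"
      using linear_bounded_pos[OF that] by (metis less_imp_le)
    have lin: "linear (\<lambda>x. P (M *v x))" for M :: "real^'i::finite^'n"
      using linear_compose[OF matrix_vector_mul_linear P(1)] by (simp add: o_def)
    obtain a where a: "\<And>x. norm (P (sysA S *v x)) \<le> a * norm x" "a \<ge> 0"
      using bounded[OF lin] by metis
    obtain b where b: "\<And>w. norm (P (sysB2 S *v w)) \<le> b * norm w" "b \<ge> 0"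
      using bounded[OF lin] by metis
    obtain c where c: "\<And>x. norm (sysC1 S *v x) \<le> c * norm x" "c \<ge> 0"
      using bounded[OF matrix_vector_mul_linear] by metis
    define \<kappa> where "\<kappa> = 96 * (a\<^sup>2 + b\<^sup>2 * c\<^sup>2)"
    have \<kappa>: "\<kappa> \<ge> 0" by (simp add: \<kappa>_def)
    \<comment> \<open>The first bound puts \<open>T\<close> below \<open>T0\<close>; the second
      gives \<open>T \<le> 1\<close> and \<open>T * \<kappa> \<le> 1\<close>, hence
      \<open>T\<^sup>2 * \<kappa> \<le> 1\<close>.\<close>
    define T where "T = min (T0 / 2) (1 / (\<kappa> + 1))"
    have T: "0 < T" "T < T0" "T \<le> 1 / (\<kappa> + 1)"
      using T0(1) \<kappa> by (auto simp: T_def)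
    have "T + T * \<kappa> \<le> 1" using T(3) \<kappa> by (simp add: field_simps)
    moreover have "0 \<le> T * \<kappa>" using T(1) \<kappa> by simp
    ultimately have "T * \<kappa> \<le> 1" "T \<le> 1" using T(1) by linarith+
    then have "T * (T * \<kappa>) \<le> 1 * 1" using T(1) \<kappa> by (intro mult_mono) auto
    then have "96 * T\<^sup>2 * (a\<^sup>2 + b\<^sup>2 * c\<^sup>2) \<le> 1"
      by (simp add: \<kappa>_def power2_eq_square mult_ac)
    then have "P x0 = 0"
      using possibly_controllable_imp_projection_zero[OF P(1) PA PB CP D1 a b c T(1)] T0(2) T by blast
    then show "controllable_state (sysA S) (sysB1 S) x0"
      by (simp add: controllable_state_def P(2))
  }
  {
    assume "controllable_state (sysA S) (sysB1 S) x0"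
    then have V: "x0 \<in> ?V" by (simp add: controllable_state_def)
    have "possibly_controllable_on S T x0" if T: "T > 0" for T
    proof -
      obtain x u where "x 0 = x0" "x T = 0" "continuous_on UNIV u"
          "\<And>t. (x has_vector_derivative sysA S *v x t + sysB1 S *v u t) (at t)"
          "\<And>t. x t \<in> ?V"
        using controllable_state_steering[OF V, of T] less_imp_neq[OF T] by metis
      then show ?thesis
        using T by (intro steered_imp_possibly_controllable[of T x]) (auto simp: C1 D1)
    qed
    \<comment> \<open>Steering succeeds on every horizon, so the threshold 1 is an arbitrary
      choice.\<close>
    then show "differentially_possibly_controllable S x0"
      unfolding differentially_possibly_controllable_def by (intro exI[of _ 1]) auto
  }
qed

end
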